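(* Let $f=\{f_n:\{0,1\}^n\to\{0,1\}^n\}_{n\in\mathbb{N}}$ be an $s(n)$-secure quantum one-way function family, and let $W_n\subseteq\{0,1\}^n$. Consider quantum registers $K$ (of arbitrary size), $O$ ($n$ qubits) and $C$ ($n$ qubits). Let $\mathcal{D}_{n,0}$ be a quantum circuit with $|\tilde\psi_{n,0}\rangle=\mathcal{D}_{n,0}|\mathbf{0}\rangle$ a state on $K\otimes O\otimes C$, and let $\mathcal{U}_n$ be a unitary circuit acting only on $K\otimes O$, with $|\tilde\psi_{n,1}\rangle=\mathcal{U}_n|\tilde\psi_{n,0}\rangle$. Define the projections $$\mathcal{P}_0=\sum_{x\in W_n}|x\rangle\langle x|_O\otimes |f_n(x)\rangle_{+}\langle f_n(x)|_C,\qquad \mathcal{P}_1=\sum_{x\in W_n}|x\rangle\langle x|_O\otimes |f_n(x)\rangle_{\times}\langle f_n(x)|_C,$$ and $b_0(n)=\|\mathcal{P}_0|\tilde\psi_{n,0}\rangle\|^2$, $b_1(n)=\|\mathcal{P}_1|\tilde\psi_{n,1}\rangle\|^2$ (the probabilities that this adversary against the Base Protocol successfully reveals $0$, resp. $1$, with a decommitment $x\in W_n$). If $b_0(n)+b_1(n)\ge 1+1/\sqrt{s(n)}$, then there exists a quantum algorithm $\mathcal{A}$, consisting of one application of $\mathcal{D}_{n,0}$, one application of $\mathcal{U}_n$ and a polynomial-size (in $n$) circuit including an evaluation of $f_n$, such that when $y''$ is drawn from the distribution of $f_n(U_n)$ conditioned on $f_n(U_n)\in f_n(W_n)$, $\mathcal{A}$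 on input $y''$ outputs some $x''\in W_n$ with $f_n(x'')=y''$ with probability $\Omega(1/s(n))$.
   Context: $U_n$ is the uniform distribution on $\{0,1\}^n$. A function family $f=\{f_n:\{0,1\}^n\to\{0,1\}^n\}$ is $s(n)$-secure quantum one-way if (i) there is a polynomial-size quantum circuit family computing $f_n(x)$ with certainty from $|x\rangle|\mathbf{0}\rangle$, and (ii) for every polynomial-size quantum circuit family $\{\mathcal{B}_n\}$ and all sufficiently large $n$, $\Pr[f_n(\mathcal{B}_n(f_n(U_n)))=f_n(U_n)]<1/s(n)$. Notation: $|b\rangle_+=|b\rangle$ is the computational basis, $|0\rangle_\times=(|0\rangle+|1\rangle)/\sqrt2$, $|1\rangle_\times=(|0\rangle-|1\rangle)/\sqrt2$, and for $z=z_1\cdots z_n$, $|z\rangle_\theta=\bigotimes_i|z_i\rangle_\theta$. The Base Protocol: to commit to $w\in\{0,1\}$ Alice picks uniform $x$ and sends $|f_n(x)\rangle_{\theta(w)}$ with $\theta(0)=+$, $\theta(1)=\times$; to reveal she announces $w,x$ and Bob measures in basis $\theta(w)$ and accepts iff the outcome is $f_n(x)$. *)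

theory Defs
  imports Complex_Main
begin

text \<open>Bit strings are boolean lists. A computational basis state of a system consisting
of a register K of dimension dK together with L qubits is a pair (k, s) with k < dK and
length s = L. State vectors are functions from such basis labels to complex amplitudes.\<close>

type_synonym bas = "nat \<times> bool list"
type_synonym vec = "bas \<Rightarrow> complex"
type_synonym qop = "bas \<Rightarrow> bas \<Rightarrow> complex"

definition strs :: "nat \<Rightarrow> bool list set" where
  "strs n = {s. length s = n}"

definition basis :: "nat \<Rightarrow> nat \<Rightarrow> bas set" where
  "basis dK L = {..<dK} \<times> strs L"

text \<open>Elementary gates: arbitrary two-qubit unitaries (matrix entry G out in).\<close>
definition gate_unitary :: "(bool \<times> bool \<Rightarrow> bool \<times> bool \<Rightarrow> complex) \<Rightarrow> bool" where
  "gate_unitary G \<longleftrightarrow> (\<forall>a b. (\<Sum>c\<in>UNIV. cnj (G c a) * G c b) = (if a = b then 1 else 0))"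

definition unitary_on :: "nat \<Rightarrow> nat \<Rightarrow> qop \<Rightarrow> bool" where
  "unitary_on dK w M \<longleftrightarrow> (\<forall>a\<in>basis dK w. \<forall>b\<in>basis dK w.
      (\<Sum>c\<in>basis dK w. cnj (M c a) * M c b) = (if a = b then 1 else 0))"

datatype instr = Gate nat nat "bool \<times> bool \<Rightarrow> bool \<times> bool \<Rightarrow> complex" | CallD | CallU

definition apply_gate :: "nat \<Rightarrow> nat \<Rightarrow> (bool \<times> bool \<Rightarrow> bool \<times> bool \<Rightarrow> complex) \<Rightarrow> vec \<Rightarrow> vec" where
  "apply_gate i j G \<psi> = (\<lambda>(k, s). \<Sum>b\<in>UNIV. G (s ! i, s ! j) b * \<psi> (k, s[i := fst b, j := snd b]))"

definition apply_op :: "nat \<Rightarrow> nat \<Rightarrow> qop \<Rightarrow> vec \<Rightarrow> vec" where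
  "apply_op dK w M \<psi> = (\<lambda>(k, s). \<Sum>(k', t)\<in>basis dK w. M (k, take w s) (k', t) * \<psi> (k', t @ drop w s))"

fun run :: "nat \<Rightarrow> qop \<Rightarrow> nat \<Rightarrow> qop \<Rightarrow> nat \<Rightarrow> instr list \<Rightarrow> vec \<Rightarrow> vec" where
  "run dK D wD U wU [] \<psi> = \<psi>"
| "run dK D wD U wU (Gate i j G # is) \<psi> = run dK D wD U wU is (apply_gate i j G \<psi>)"
| "run dK D wD U wU (CallD # is) \<psi> = run dK D wD U wU is (apply_op dK wD D \<psi>)"
| "run dK D wD U wU (CallU # is) \<psi> = run dK D wD U wU is (apply_op dK wU U \<psi>)"

definition valid_circ :: "nat \<Rightarrow> instr list \<Rightarrow> bool" where
  "valid_circ L is \<longleftrightarrow> (\<forall>ins\<in>set is. case ins of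
      Gate i j G \<Rightarrow> i < L \<and> j < L \<and> i \<noteq> j \<and> gate_unitary G | _ \<Rightarrow> True)"

definition is_CallD :: "instr \<Rightarrow> bool" where
  "is_CallD ins = (case ins of CallD \<Rightarrow> True | _ \<Rightarrow> False)"

definition is_CallU :: "instr \<Rightarrow> bool" where
  "is_CallU ins = (case ins of CallU \<Rightarrow> True | _ \<Rightarrow> False)"

definition gates_only :: "instr list \<Rightarrow> bool" where
  "gates_only is \<longleftrightarrow> (\<forall>ins\<in>set is. \<not> is_CallD ins \<and> \<not> is_CallU ins)"

definition run_plain :: "instr list \<Rightarrow> vec \<Rightarrow> vec" where
  "run_plain is \<psi> = run 1 (\<lambda>_ _. 0) 0 (\<lambda>_ _. 0) 0 is \<psi>"

definition basis_vec :: "bas \<Rightarrow> vec" where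
  "basis_vec b = (\<lambda>a. if a = b then 1 else 0)"

definition poly_bounded :: "(nat \<Rightarrow> nat) \<Rightarrow> bool" where
  "poly_bounded p \<longleftrightarrow> (\<exists>c (d::nat). \<forall>n. real (p n) \<le> c * (real n + 1) ^ d)"

definition qcomputable :: "(nat \<Rightarrow> bool list \<Rightarrow> bool list) \<Rightarrow> bool" where
  "qcomputable f \<longleftrightarrow> (\<exists>p. poly_bounded p \<and> (\<forall>n. \<exists>L is.
      2 * n \<le> L \<and> valid_circ L is \<and> gates_only is \<and> length is + L \<le> p n \<and>
      (\<forall>x\<in>strs n. (\<Sum>s\<in>strs L. if take n (drop n s) = f n x
          then (cmod (run_plain is (basis_vec (0, x @ replicate (L - n) False)) (0, s)))\<^sup>2 else 0) = 1)))"

definition inv_prob :: "(nat \<Rightarrow> bool list \<Rightarrow> bool list) \<Rightarrow> nat \<Rightarrow> nat \<Rightarrow> instr list \<Rightarrow> real" where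
  "inv_prob f n L is = (\<Sum>x\<in>strs n. \<Sum>s\<in>strs L.
      if f n (take n s) = f n x
      then (cmod (run_plain is (basis_vec (0, f n x @ replicate (L - n) False)) (0, s)))\<^sup>2 else 0) / 2 ^ n"

definition qow_secure :: "(nat \<Rightarrow> bool list \<Rightarrow> bool list) \<Rightarrow> (nat \<Rightarrow> real) \<Rightarrow> bool" where
  "qow_secure f s \<longleftrightarrow>
     (\<forall>n. \<forall>x\<in>strs n. f n x \<in> strs n) \<and>
     qcomputable f \<and>
     (\<forall>B :: nat \<Rightarrow> nat \<times> instr list.
        (poly_bounded (\<lambda>n. length (snd (B n)) + fst (B n)) \<and>
         (\<forall>n. n \<le> fst (B n) \<and> valid_circ (fst (B n)) (snd (B n)) \<and> gates_only (snd (B n))))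
        \<longrightarrow> (\<exists>N. \<forall>n\<ge>N. inv_prob f n (fst (B n)) (snd (B n)) < 1 / s n))"

text \<open>Conjugate (Hadamard) basis amplitude: <z|_x |c> for n-bit strings.\<close>
definition had :: "nat \<Rightarrow> bool list \<Rightarrow> bool list \<Rightarrow> complex" where
  "had n z c = complex_of_real ((-1) ^ card {i. i < n \<and> z ! i \<and> c ! i} / sqrt (2 ^ n))"

text \<open>Registers: K (dimension dK), O = qubits 0..n-1, C = qubits n..2n-1.
psi0 = D|0>, psi1 = U psi0 with U acting on K and O.\<close>
definition psi0 :: "nat \<Rightarrow> qop \<Rightarrow> vec" where
  "psi0 n D = (\<lambda>b. D b (0, replicate (2 * n) False))"

definition psi1 :: "nat \<Rightarrow> nat \<Rightarrow> qop \<Rightarrow> qop \<Rightarrow> vec" where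
  "psi1 n dK D U = apply_op dK n U (psi0 n D)"

definition b0 :: "(nat \<Rightarrow> bool list \<Rightarrow> bool list) \<Rightarrow> nat \<Rightarrow> bool list set \<Rightarrow> nat \<Rightarrow> qop \<Rightarrow> real" where
  "b0 f n W dK D = (\<Sum>k<dK. \<Sum>x\<in>W. (cmod (psi0 n D (k, x @ f n x)))\<^sup>2)"

definition b1 :: "(nat \<Rightarrow> bool list \<Rightarrow> bool list) \<Rightarrow> nat \<Rightarrow> bool list set \<Rightarrow> nat \<Rightarrow> qop \<Rightarrow> qop \<Rightarrow> real" where
  "b1 f n W dK D U = (\<Sum>k<dK. \<Sum>x\<in>W.
      (cmod (\<Sum>c\<in>strs n. had n (f n x) c * psi1 n dK D U (k, x @ c)))\<^sup>2)"

text \<open>Algorithm A: width L \<ge> 3n; qubits 0..2n-1 are O,C (where D and U act, with K);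
input y is placed on qubits 2n..3n-1, everything else starts in 0; output x'' is the
measurement of qubits 0..n-1. success = probability that x'' \<in> W and f(x'') = y'',
with y'' distributed as f_n(U_n) conditioned on f_n(U_n) \<in> f_n(W).\<close>
definition inv_success ::
  "(nat \<Rightarrow> bool list \<Rightarrow> bool list) \<Rightarrow> nat \<Rightarrow> bool list set \<Rightarrow> nat \<Rightarrow> qop \<Rightarrow> qop \<Rightarrow> nat \<Rightarrow> instr list \<Rightarrow> real" where
  "inv_success f n W dK D U L is =
     (\<Sum>y\<in>f n ` W.
        (real (card {x\<in>strs n. f n x = y}) / real (card {x\<in>strs n. f n x \<in> f n ` W})) *
        (\<Sum>(k, s)\<in>basis dK L.
           if take n s \<in> W \<and> f n (take n s) = y
           then (cmod (run dK D (2 * n) U n is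
                  (basis_vec (0, replicate (2 * n) False @ y @ replicate (L - 3 * n) False)) (k, s)))\<^sup>2
           else 0))"

end

theory Submission
  imports "HOL-Analysis.Analysis" Defs
begin

text \<open>Let Q be the projection onto those basis states whose C register holds the image under f of
the O register; unlike the projection of the theorem it does not mention W. Since Q dominates the
projection defining b0, the part of the state rejected by Q has squared norm at most 1 - b0, and the
triangle inequality gives \<open>\<parallel>P1 U Q \<psi>\<parallel> \<ge> sqrt b1 - sqrt (1 - b0) \<ge> 1 / (2 sqrt s)\<close>.

U does not touch C, and in \<open>Q \<psi>\<close> the content of C is a function of O. Hence the overlap of C with
the conjugate basis vector y only contributes the phase \<open>(-1)^(y \<cdot> f(z))\<close> to the branch in which O
holds z. The inverter imprints this phase with controlled-Z gates between C and its input y, then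
XORs f(O) into C by computing f, copying and uncomputing, and applies U. The branch in which C is zero
carries the amplitudes of \<open>P1 U Q \<psi>\<close> up to the factor \<open>sqrt (2^n)\<close>. Neither measuring C nor testing
membership in W is needed.\<close>

section \<open>Isometries in coordinates\<close>

text \<open>Expanding the squared norm gives a triple sum in which orthonormality of the columns of
  \<open>M\<close> kills all cross terms. It serves for single gates, with \<open>B\<close> the four
  values of two bits, and for \<open>U\<close>.\<close>

lemma isometry_sum:
  fixes M :: "'a \<Rightarrow> 'a \<Rightarrow> complex"
  assumes "finite B"
    and M: "\<And>a b. a \<in> B \<Longrightarrow> b \<in> B \<Longrightarrow> (\<Sum>c\<in>B. cnj (M c a) * M c b) = (if a = b then 1 else 0)"
  shows "(\<Sum>a\<in>B. (cmod (\<Sum>b\<in>B. M a b * v b))\<^sup>2) = (\<Sum>b\<in>B. (cmod (v b))\<^sup>2)"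
proof -
  have "complex_of_real (\<Sum>a\<in>B. (cmod (\<Sum>b\<in>B. M a b * v b))\<^sup>2)
      = (\<Sum>a\<in>B. \<Sum>b\<in>B. \<Sum>b'\<in>B. (v b * cnj (v b')) * (cnj (M a b') * M a b))"
    by (simp only: of_real_sum complex_norm_square cnj_sum sum_product complex_cnj_mult mult_ac)
  also have "\<dots> = (\<Sum>b\<in>B. \<Sum>b'\<in>B. \<Sum>a\<in>B. (v b * cnj (v b')) * (cnj (M a b') * M a b))"
    by (rule trans[OF sum.swap], rule sum.cong[OF refl], rule sum.swap)
  also have "\<dots> = (\<Sum>b\<in>B. \<Sum>b'\<in>B. (v b * cnj (v b')) * (if b' = b then 1 else 0))"
    by (intro sum.cong refl) (simp add: M flip: sum_distrib_left)
  also have "\<dots> = (\<Sum>b\<in>B. v b * cnj (v b))"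
    using \<open>finite B\<close> by (intro sum.cong refl) (simp add: if_distrib cong: if_cong)
  also have "\<dots> = complex_of_real (\<Sum>b\<in>B. (cmod (v b))\<^sup>2)"
    by (simp only: of_real_sum complex_norm_square)
  finally show ?thesis
    using of_real_eq_iff by blast
qed

section \<open>Bit strings and evolution under gate lists\<close>

lemma finite_strs [simp]: "finite (strs n)"
  using finite_lists_length_eq[of "UNIV :: bool set" n] by (simp add: strs_def)

lemma card_strs: "card (strs n) = 2 ^ n"
  using card_lists_length_eq[of "UNIV :: bool set" n] by (simp add: strs_def)

lemma finite_basis [simp]: "finite (basis dK L)"
  by (simp add: basis_def)

lemma run_append:
  "run dK D wD U wU (as @ bs) \<psi> = run dK D wD U wU bs (run dK D wD U wU as \<psi>)"
proof (induction as arbitrary: \<psi>)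
  case (Cons a as)
  then show ?case by (cases a) auto
qed simp

lemma run_plain_simps [simp]:
  "run_plain [] \<psi> = \<psi>"
  "run_plain (Gate i j G # gs) \<psi> = run_plain gs (apply_gate i j G \<psi>)"
  "run_plain (as @ bs) \<psi> = run_plain bs (run_plain as \<psi>)"
  by (simp_all add: run_plain_def run_append)

lemma gates_only_simps [simp]:
  "gates_only []"
  "gates_only (Gate i j G # gs) \<longleftrightarrow> gates_only gs"
  "\<not> gates_only (CallD # gs)"
  "\<not> gates_only (CallU # gs)"
  "gates_only (as @ bs) \<longleftrightarrow> gates_only as \<and> gates_only bs"
  by (auto simp: gates_only_def is_CallD_def is_CallU_def)

lemma valid_circ_simps [simp]:
  "valid_circ L []"
  "valid_circ L (Gate i j G # gs) \<longleftrightarrow> i < L \<and> j < L \<and> i \<noteq> j \<and> gate_unitary G \<and> valid_circ L gs"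
  "valid_circ L (CallD # gs) \<longleftrightarrow> valid_circ L gs"
  "valid_circ L (CallU # gs) \<longleftrightarrow> valid_circ L gs"
  "valid_circ L (as @ bs) \<longleftrightarrow> valid_circ L as \<and> valid_circ L bs"
  by (auto simp: valid_circ_def)

lemma gates_only_induct [consumes 1, case_names Nil Gate]:
  assumes "gates_only gs"
    and "P []"
    and "\<And>i j G gs. gates_only gs \<Longrightarrow> P gs \<Longrightarrow> P (Gate i j G # gs)"
  shows "P gs"
  using assms(1)
proof (induction gs)
  case (Cons g gs)
  then show ?case by (cases g) (auto intro: assms(3))
qed (rule assms(2))

lemma gates_only_rev_induct [consumes 1, case_names Nil Gate]:
  assumes "gates_only gs"
    and "P []"
    and "\<And>i j G gs. gates_only gs \<Longrightarrow> P gs \<Longrightarrow> P (gs @ [Gate i j G])"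
  shows "P gs"
  using assms(1)
proof (induction gs rule: rev_induct)
  case (snoc g gs)
  then show ?case by (cases g) (auto intro: assms(3))
qed (rule assms(2))

lemma run_gates_only: "gates_only gs \<Longrightarrow> run dK D wD U wU gs \<psi> = run_plain gs \<psi>"
  by (induction gs arbitrary: \<psi> rule: gates_only_induct) auto

lemma filter_gates_only:
  "gates_only gs \<Longrightarrow> filter is_CallD gs = [] \<and> filter is_CallU gs = []"
  by (auto simp: gates_only_def)

text \<open>Gates change neither \<open>k\<close> nor the length of the string. Vectors are total
  functions on all labels, so facts known for one width only can pass through a circuit in this
  pointwise form.\<close>

lemma run_plain_cong:
  assumes "gates_only gs" "\<And>t. length t = length s \<Longrightarrow> \<phi> (k, t) = \<psi> (k, t)"
  shows "run_plain gs \<phi> (k, s) = run_plain gs \<psi> (k, s)"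
  using assms
  by (induction gs arbitrary: \<phi> \<psi> rule: gates_only_induct) (auto simp: apply_gate_def)

text \<open>Linearity of the evolution. The induction peels off the last gate, because the remaining
  gates then form the vector under its sum.\<close>

lemma run_plain_sum:
  assumes "gates_only gs"
  shows "run_plain gs (\<lambda>b. \<Sum>x\<in>S. c x * v x b) b = (\<Sum>x\<in>S. c x * run_plain gs (v x) b)"
  using assms
proof (induction gs arbitrary: b rule: gates_only_rev_induct)
  case (Gate i j G gs)
  show ?case
    by (cases b) (simp add: apply_gate_def Gate sum_distrib_left sum.swap[of _ S] mult_ac)
qed simp

lemma run_plain_norm:
  assumes "gates_only gs" "valid_circ L gs"
  shows "(\<Sum>s\<in>strs L. (cmod (run_plain gs \<psi> (k, s)))\<^sup>2) = (\<Sum>s\<in>strs L. (cmod (\<psi> (k, s)))\<^sup>2)"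
  using assms
proof (induction gs arbitrary: \<psi> rule: gates_only_induct)
  case (Gate i j G gs)
  define u where "u = (\<lambda>s (a :: bool \<times> bool). s[i := fst a, j := snd a])"
  from Gate have ij: "i < L" "j < L" "i \<noteq> j" and G: "gate_unitary G" and gs: "valid_circ L gs"
    by auto
  \<comment> \<open>Averaging over the contents of qubits i, j reduces the claim to a single 4 x 4 block.\<close>
  have avg: "(\<Sum>s\<in>strs L. \<Sum>a\<in>UNIV. h (u s a)) = 4 * (\<Sum>s\<in>strs L. h s)"
    for h :: "bool list \<Rightarrow> real"
  proof -
    have "(\<Sum>s\<in>strs L. \<Sum>a\<in>UNIV. h (u s a)) = (\<Sum>(s, a)\<in>strs L \<times> UNIV. h (u s a))"
      by (simp add: sum.cartesian_product)
    \<comment> \<open>The reindexing swaps the label \<open>a\<close> with the bits held at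
      positions \<open>i\<close> and \<open>j\<close>; it is an involution and so serves as its own
      inverse.\<close>
    also have "\<dots> = (\<Sum>(s, a)\<in>strs L \<times> (UNIV :: (bool \<times> bool) set). h s)"
      by (rule sum.reindex_bij_witness[where i = "\<lambda>(s, a). (u s a, (s ! i, s ! j))"
            and j = "\<lambda>(s, a). (u s a, (s ! i, s ! j))"])
        (use ij in \<open>auto simp: u_def strs_def nth_list_update intro!: nth_equalityI split: if_splits\<close>)
    also have "\<dots> = (\<Sum>s\<in>strs L. \<Sum>a\<in>(UNIV :: (bool \<times> bool) set). h s)"
      by (rule sum.cartesian_product[symmetric])
    also have "\<dots> = 4 * (\<Sum>s\<in>strs L. h s)"
      by (simp add: UNIV_bool sum_distrib_left flip: UNIV_Times_UNIV)
    finally show ?thesis .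
  qed
  have block: "apply_gate i j G \<psi> (k, u s a) = (\<Sum>b\<in>UNIV. G a b * \<psi> (k, u s b))"
    if "s \<in> strs L" for s a
  proof -
    have "u s a ! i = fst a" "u s a ! j = snd a" "(u s a)[i := fst b, j := snd b] = u s b" for b
      using ij that by (auto simp: u_def strs_def list_update_swap[of i j])
    then show ?thesis by (simp add: apply_gate_def)
  qed
  have "4 * (\<Sum>s\<in>strs L. (cmod (apply_gate i j G \<psi> (k, s)))\<^sup>2)
     = (\<Sum>s\<in>strs L. \<Sum>a\<in>UNIV. (cmod (apply_gate i j G \<psi> (k, u s a)))\<^sup>2)"
    by (rule avg[symmetric])
  also have "\<dots> = (\<Sum>s\<in>strs L. \<Sum>a\<in>UNIV. (cmod (\<Sum>b\<in>UNIV. G a b * \<psi> (k, u s b)))\<^sup>2)"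
    by (simp add: block)
  also have "\<dots> = (\<Sum>s\<in>strs L. \<Sum>a\<in>UNIV. (cmod (\<psi> (k, u s a)))\<^sup>2)"
    using G unfolding gate_unitary_def by (intro sum.cong[OF refl] isometry_sum finite) blast
  also have "\<dots> = 4 * (\<Sum>s\<in>strs L. (cmod (\<psi> (k, s)))\<^sup>2)"
    by (rule avg)
  finally show ?case
    using Gate.IH[OF gs] by simp
qed simp

section \<open>Reversing a circuit\<close>

definition adjoint_gate :: "instr \<Rightarrow> instr" where
  "adjoint_gate g = (case g of Gate i j G \<Rightarrow> Gate i j (\<lambda>a b. cnj (G b a)) | _ \<Rightarrow> g)"

definition inverse_circ :: "instr list \<Rightarrow> instr list" where
  "inverse_circ gs = rev (map adjoint_gate gs)"

lemma inverse_circ_simps [simp]: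
  "inverse_circ [] = []"
  "inverse_circ (Gate i j G # gs) = inverse_circ gs @ [Gate i j (\<lambda>a b. cnj (G b a))]"
  "length (inverse_circ gs) = length gs"
  by (simp_all add: inverse_circ_def adjoint_gate_def)

text \<open>\<open>gate_unitary\<close> speaks of orthonormal columns, while the adjoint needs this
  of the rows. For square matrices a left inverse is a right inverse.\<close>

lemma gate_unitary_adjoint:
  assumes "gate_unitary G"
  shows "gate_unitary (\<lambda>a b. cnj (G b a))"
proof -
  define A :: "complex ^ (bool \<times> bool) ^ (bool \<times> bool)" where "A = (\<chi> a b. G a b)"
  define A' :: "complex ^ (bool \<times> bool) ^ (bool \<times> bool)" where "A' = (\<chi> a b. cnj (G b a))"
  have "A' ** A = mat 1"
    using assms by (simp add: vec_eq_iff matrix_matrix_mult_def mat_def A_def A'_def gate_unitary_def)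
  then have "A ** A' = mat 1"
    using matrix_left_right_inverse by blast
  then show ?thesis
    by (simp add: vec_eq_iff matrix_matrix_mult_def mat_def A_def A'_def gate_unitary_def)
qed

lemma valid_inverse_circ:
  "gates_only gs \<Longrightarrow> valid_circ L gs \<Longrightarrow> valid_circ L (inverse_circ gs)"
  by (induction gs rule: gates_only_induct) (auto intro: gate_unitary_adjoint)

lemma gates_only_inverse_circ: "gates_only gs \<Longrightarrow> gates_only (inverse_circ gs)"
  by (induction gs rule: gates_only_induct) auto

text \<open>The tail and its inverse sit next to each other and cancel by induction; what is left is
  the first gate followed by its adjoint, which cancel because the columns of the gate are
  orthonormal.\<close>

lemma run_inverse_circ:
  assumes "gates_only gs" "valid_circ (length s) gs"
  shows "run_plain (inverse_circ gs) (run_plain gs \<psi>) (k, s) = \<psi> (k, s)"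
  using assms
proof (induction gs arbitrary: \<psi> s rule: gates_only_induct)
  case (Gate i j G gs)
  then have ij: "i < length s" "j < length s" "i \<noteq> j"
    and G: "gate_unitary G" and gs: "valid_circ (length s) gs"
    by auto
  have G': "(\<Sum>b\<in>UNIV. cnj (G b (s ! i, s ! j)) * G b c) = (if (s ! i, s ! j) = c then 1 else 0)" for c
    using G unfolding gate_unitary_def by blast
  have upd: "s[i := a, j := b, i := c, j := d] = s[i := c, j := d]" for a b c d
    using ij by (auto simp: list_update_swap[of i j])
  have "run_plain (inverse_circ (Gate i j G # gs)) (run_plain (Gate i j G # gs) \<psi>) (k, s)
      = (\<Sum>b\<in>UNIV. cnj (G b (s ! i, s ! j)) * apply_gate i j G \<psi> (k, s[i := fst b, j := snd b]))"
    by (simp add: apply_gate_def Gate.IH gs)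
  also have "\<dots> = (\<Sum>b\<in>UNIV. \<Sum>c\<in>UNIV. cnj (G b (s ! i, s ! j)) * G b c * \<psi> (k, s[i := fst c, j := snd c]))"
    using ij by (simp add: apply_gate_def upd sum_distrib_left mult.assoc)
  also have "\<dots> = (\<Sum>c\<in>UNIV. (\<Sum>b\<in>UNIV. cnj (G b (s ! i, s ! j)) * G b c) * \<psi> (k, s[i := fst c, j := snd c]))"
    by (subst sum.swap) (simp add: sum_distrib_right)
  also have "\<dots> = (\<Sum>c\<in>UNIV. if (s ! i, s ! j) = c then \<psi> (k, s[i := fst c, j := snd c]) else 0)"
    by (intro sum.cong refl) (simp only: G', simp)
  also have "\<dots> = \<psi> (k, s)"
    by (subst sum.delta') auto
  finally show ?case .
qed simp

section \<open>Running a circuit around a gap of untouched wires\<close>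

text \<open>Opens a gap of \<open>m\<close> wires at position \<open>n\<close>. With
  \<open>m = 2 * n\<close> a circuit for f keeps its input on O, the gap holds C and the input y,
  and the other wires of the circuit start at \<open>3 * n\<close>.\<close>

definition insert_qubits :: "nat \<Rightarrow> nat \<Rightarrow> instr \<Rightarrow> instr" where
  "insert_qubits n m g = (case g of
     Gate i j G \<Rightarrow> Gate (if i < n then i else i + m) (if j < n then j else j + m) G | _ \<Rightarrow> g)"

lemma insert_qubits_Gate [simp]:
  "insert_qubits n m (Gate i j G)
     = Gate (if i < n then i else i + m) (if j < n then j else j + m) G"
  by (simp add: insert_qubits_def)

lemma gates_only_insert_qubits: "gates_only gs \<Longrightarrow> gates_only (map (insert_qubits n m) gs)"
  by (induction gs rule: gates_only_induct) auto

lemma valid_insert_qubits: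
  "gates_only gs \<Longrightarrow> valid_circ L gs \<Longrightarrow> valid_circ (L + m) (map (insert_qubits n m) gs)"
  by (induction gs rule: gates_only_induct) auto

text \<open>No gate touches the gap or K, so \<open>w\<close> and \<open>k\<close> are mere
  parameters: the slice of the state with these values evolves under the original circuit, whose own
  K index is fixed to 0.\<close>

lemma run_insert_qubits:
  assumes "gates_only gs" "valid_circ (length g) gs" "n \<le> length g" "length w = m"
  shows "run_plain (map (insert_qubits n m) gs) \<psi> (k, take n g @ w @ drop n g)
       = run_plain gs (\<lambda>(_, t). \<psi> (k, take n t @ w @ drop n t)) (0, g)"
  using assms
proof (induction gs arbitrary: g rule: gates_only_rev_induct)
  case (Gate i j G gs)
  define e where "e t = take n t @ w @ drop n t" for t :: "bool list"
  define q where "q i = (if i < n then i else i + m)" for i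
  have nth: "e t ! q l = t ! l" if "l < length t" "n \<le> length t" for l t
    using that \<open>length w = m\<close> by (auto simp: e_def q_def nth_append)
  have upd: "(e t)[q l := b] = e (t[l := b])" if "l < length t" "n \<le> length t" for l t b
    using that \<open>length w = m\<close>
  proof (cases "l < n")
    case True
    with that \<open>length w = m\<close> show ?thesis
      by (simp add: e_def q_def list_update_append take_update_swap)
  next
    case False
    with that \<open>length w = m\<close> show ?thesis
      by (auto simp: e_def q_def list_update_append drop_update_swap)
  qed
  have ij: "i < length g" "j < length g" and n: "n \<le> length g"
    using Gate.prems by auto
  have IH: "run_plain (map (insert_qubits n m) gs) \<psi> (k, e t)
      = run_plain gs (\<lambda>(_, t). \<psi> (k, e t)) (0, t)" if "length t = length g" for t
    unfolding e_def using Gate.prems that by (intro Gate.IH) auto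
  have "run_plain (map (insert_qubits n m) (gs @ [Gate i j G])) \<psi> (k, e g)
      = (\<Sum>b\<in>UNIV. G (e g ! q i, e g ! q j) b
          * run_plain (map (insert_qubits n m) gs) \<psi> (k, (e g)[q i := fst b, q j := snd b]))"
    by (simp add: apply_gate_def q_def)
  also have "\<dots> = run_plain (gs @ [Gate i j G]) (\<lambda>(_, t). \<psi> (k, e t)) (0, g)"
    using ij n by (simp add: nth upd IH apply_gate_def)
  finally show ?case
    unfolding e_def .
qed simp

section \<open>Layers of CNOT and controlled-Z gates\<close>

definition cnot :: "bool \<times> bool \<Rightarrow> bool \<times> bool \<Rightarrow> complex" where
  "cnot a b = (if b = (fst a, snd a \<noteq> fst a) then 1 else 0)"

definition cz :: "bool \<times> bool \<Rightarrow> bool \<times> bool \<Rightarrow> complex" where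
  "cz a b = (if b = a then (if fst a \<and> snd a then -1 else 1) else 0)"

lemma gate_unitary_cnot: "gate_unitary cnot" and gate_unitary_cz: "gate_unitary cz"
  by (simp_all add: gate_unitary_def cnot_def cz_def all_bool_eq UNIV_bool flip: UNIV_Times_UNIV)

lemma apply_cnot: "apply_gate i j cnot \<psi> (k, s) = \<psi> (k, s[j := s ! j \<noteq> s ! i])"
  by (simp add: apply_gate_def cnot_def if_distrib[of "\<lambda>z. z * _"] cong: if_cong)

lemma apply_cz: "apply_gate i j cz \<psi> (k, s) = (if s ! i \<and> s ! j then -1 else 1) * \<psi> (k, s)"
  by (simp add: apply_gate_def cz_def if_distrib[of "\<lambda>z. z * _"] cong: if_cong)

definition cz_circ :: "nat \<Rightarrow> nat \<Rightarrow> instr list" where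
  "cz_circ n m = map (\<lambda>i. Gate (n + i) (2 * n + i) cz) [0..<m]"

text \<open>After a gap of \<open>2 * n\<close> wires is opened, the output of a circuit for f sits
  on wires \<open>3 * n\<close> to \<open>4 * n - 1\<close>; C starts at wire
  \<open>n\<close>.\<close>

definition cnot_circ :: "nat \<Rightarrow> nat \<Rightarrow> instr list" where
  "cnot_circ n m = map (\<lambda>i. Gate (3 * n + i) (n + i) cnot) [0..<m]"

lemma gates_only_cz_circ: "gates_only (cz_circ n m)"
  and gates_only_cnot_circ: "gates_only (cnot_circ n m)"
  by (auto simp: gates_only_def cz_circ_def cnot_circ_def is_CallD_def is_CallU_def)

text \<open>For \<open>m = n\<close> the sign is the numerator of \<open>had\<close> for the
  contents of y and C.\<close>

lemma run_cz_circ: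
  "run_plain (cz_circ n m) \<psi> (k, s)
     = (-1) ^ card {i. i < m \<and> s ! (2 * n + i) \<and> s ! (n + i)} * \<psi> (k, s)"
proof (induction m)
  case (Suc m)
  have "{i. i < Suc m \<and> s ! (2 * n + i) \<and> s ! (n + i)}
      = (if s ! (2 * n + m) \<and> s ! (n + m) then insert m else id)
          {i. i < m \<and> s ! (2 * n + i) \<and> s ! (n + i)}"
    by (auto simp: less_Suc_eq)
  with Suc show ?case
    by (simp add: cz_circ_def apply_cz)
qed (simp add: cz_circ_def)

lemma run_cnot_circ:
  assumes "m \<le> n" "4 * n \<le> length s"
  shows "run_plain (cnot_circ n m) \<psi> (k, s)
     = \<psi> (k, map (\<lambda>p. if n \<le> p \<and> p < n + m then s ! p \<noteq> s ! (p + 2 * n) else s ! p) [0..<length s])"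
  using assms
proof (induction m arbitrary: s)
  case 0
  have "map (\<lambda>p. if n \<le> p \<and> p < n + 0 then s ! p \<noteq> s ! (p + 2 * n) else s ! p) [0..<length s] = s"
    by (intro nth_equalityI) auto
  then show ?case by (simp add: cnot_circ_def)
next
  case (Suc m)
  \<comment> \<open>Gate \<open>m\<close> is the last in the list, so on amplitudes its update of
    the argument is made first.\<close>
  define s' where "s' = s[n + m := s ! (n + m) \<noteq> s ! (3 * n + m)]"
  have "run_plain (cnot_circ n (Suc m)) \<psi> (k, s) = run_plain (cnot_circ n m) \<psi> (k, s')"
    by (simp add: cnot_circ_def apply_cnot s'_def)
  also have "\<dots> = \<psi> (k, map (\<lambda>p. if n \<le> p \<and> p < n + m then s' ! p \<noteq> s' ! (p + 2 * n) else s' ! p) [0..<length s'])"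
    using Suc.prems by (intro Suc.IH) (auto simp: s'_def)
  also have "map (\<lambda>p. if n \<le> p \<and> p < n + m then s' ! p \<noteq> s' ! (p + 2 * n) else s' ! p) [0..<length s']
      = map (\<lambda>p. if n \<le> p \<and> p < n + Suc m then s ! p \<noteq> s ! (p + 2 * n) else s ! p) [0..<length s]"
    using Suc.prems by (intro nth_equalityI) (auto simp: s'_def nth_list_update less_Suc_eq algebra_simps)
  finally show ?case .
qed

section \<open>The inverter built from an exact circuit for f\<close>

text \<open>\<open>computes\<close> constrains only the output wires: the other wires may end in
  garbage that depends on the input. This is why the output is copied out and the circuit then
  undone.\<close>

locale exact_circuit =
  fixes f :: "bool list \<Rightarrow> bool list" and n L :: nat and F :: "instr list"
  assumes width: "2 * n \<le> L"
    and valid: "valid_circ L F"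
    and gates: "gates_only F"
    and range: "x \<in> strs n \<Longrightarrow> f x \<in> strs n"
    and computes: "x \<in> strs n \<Longrightarrow> (\<Sum>s\<in>strs L. if take n (drop n s) = f x
          then (cmod (run_plain F (basis_vec (0, x @ replicate (L - n) False)) (0, s)))\<^sup>2 else 0) = 1"
begin

abbreviation zeros :: "bool list" where
  "zeros \<equiv> replicate (L - n) False"

abbreviation amp :: "bool list \<Rightarrow> bool list \<Rightarrow> complex" where
  "amp x g \<equiv> run_plain F (basis_vec (0, x @ zeros)) (0, g)"

text \<open>The total probability is 1 and so is that of the correct outputs; the difference is a
  sum of nonnegative terms with value 0, so each term vanishes.\<close>

lemma amp_support:
  assumes x: "x \<in> strs n" and g: "g \<in> strs L" and out: "take n (drop n g) \<noteq> f x"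
  shows "amp x g = 0"
proof -
  have "(\<Sum>s\<in>strs L. (cmod (amp x s))\<^sup>2)
      = (\<Sum>s\<in>strs L. (cmod (basis_vec (0, x @ zeros) (0, s)))\<^sup>2)"
    by (rule run_plain_norm[OF gates valid])
  also have "\<dots> = (\<Sum>s\<in>strs L. if s = x @ zeros then 1 else 0)"
    by (intro sum.cong) (auto simp: basis_vec_def)
  also have "\<dots> = 1"
  proof -
    have "x @ zeros \<in> strs L"
      using x width by (simp add: strs_def)
    then show ?thesis by simp
  qed
  finally have "(\<Sum>s\<in>strs L. (cmod (amp x s))\<^sup>2
      - (if take n (drop n s) = f x then (cmod (amp x s))\<^sup>2 else 0)) = 0"
    using computes[OF x] by (simp add: sum_subtractf)
  then have "(cmod (amp x g))\<^sup>2 - (if take n (drop n g) = f x then (cmod (amp x g))\<^sup>2 else 0) = 0"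
    using g by (subst (asm) sum_nonneg_eq_0_iff) auto
  with out show ?thesis by simp
qed

abbreviation F' :: "instr list" where
  "F' \<equiv> map (insert_qubits n (2 * n)) F"

lemma run_F':
  assumes g: "g \<in> strs L" and w: "length w = 2 * n"
    and zero: "\<And>s. length s = L + 2 * n \<Longrightarrow> drop (3 * n) s \<noteq> zeros \<Longrightarrow> \<xi> (k, s) = 0"
  shows "run_plain F' \<xi> (k, take n g @ w @ drop n g) = (\<Sum>x\<in>strs n. \<xi> (k, x @ w @ zeros) * amp x g)"
proof -
  have "run_plain F' \<xi> (k, take n g @ w @ drop n g)
      = run_plain F (\<lambda>(_, t). \<xi> (k, take n t @ w @ drop n t)) (0, g)"
    using g w width valid gates by (intro run_insert_qubits) (auto simp: strs_def)
  also have "\<dots> = run_plain F (\<lambda>b. \<Sum>x\<in>strs n. \<xi> (k, x @ w @ zeros) * basis_vec (0, x @ zeros) b) (0, g)"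
  proof (rule run_plain_cong[OF gates])
    fix t :: "bool list" assume "length t = length g"
    with g have t: "length t = L" by (simp add: strs_def)
    have eq: "t = x @ zeros \<longleftrightarrow> drop n t = zeros \<and> x = take n t" if "x \<in> strs n" for x
      using that append_eq_conv_conj[of x zeros t] by (auto simp: strs_def)
    have "(\<Sum>x\<in>strs n. \<xi> (k, x @ w @ zeros) * basis_vec (0, x @ zeros) (0, t))
        = (\<Sum>x\<in>strs n. if x = take n t then (if drop n t = zeros then \<xi> (k, x @ w @ zeros) else 0) else 0)"
      by (intro sum.cong refl) (auto simp: basis_vec_def eq)
    also have "\<dots> = (if drop n t = zeros then \<xi> (k, take n t @ w @ zeros) else 0)"
    proof -
      have "take n t \<in> strs n"
        using t width by (simp add: strs_def)
      then show ?thesis by simp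
    qed
    also have "\<dots> = \<xi> (k, take n t @ w @ drop n t)"
    proof (cases "drop n t = zeros")
      case False
      have "drop (3 * n) (take n t @ w @ drop n t) = drop n t"
        using t width w by simp
      with False t width w have "\<xi> (k, take n t @ w @ drop n t) = 0"
        by (intro zero) simp_all
      with False show ?thesis by simp
    qed simp
    finally show "(\<lambda>(_, t). \<xi> (k, take n t @ w @ drop n t)) (0, t)
        = (\<Sum>x\<in>strs n. \<xi> (k, x @ w @ zeros) * basis_vec (0, x @ zeros) (0, t))"
      by simp
  qed
  also have "\<dots> = (\<Sum>x\<in>strs n. \<xi> (k, x @ w @ zeros) * amp x g)"
    by (rule run_plain_sum[OF gates])
  finally show ?thesis .
qed

text \<open>By \<open>amp_support\<close> every branch after \<open>F'\<close> carries the correct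
  output f(x), so copying this output into C amounts to having XORed f(x) beforehand, which is the
  state \<open>\<psi>'\<close>. The inverse circuit then removes \<open>F'\<close> together with its
  garbage.\<close>

lemma run_oracle:
  fixes \<psi> :: vec
  assumes s: "length s = L + 2 * n"
    and zero: "\<And>s. length s = L + 2 * n \<Longrightarrow> drop (3 * n) s \<noteq> zeros \<Longrightarrow> \<psi> (k, s) = 0"
  shows "run_plain (F' @ cnot_circ n n @ inverse_circ F') \<psi> (k, s)
    = \<psi> (k, take n s @ map2 (\<noteq>) (take n (drop n s)) (f (take n s)) @ drop (2 * n) s)"
proof -
  define \<psi>' :: vec where
    "\<psi>' = (\<lambda>(k, s). \<psi> (k, take n s @ map2 (\<noteq>) (take n (drop n s)) (f (take n s)) @ drop (2 * n) s))"
  have zero': "\<psi>' (k, t) = 0" if "length t = L + 2 * n" "drop (3 * n) t \<noteq> zeros" for t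
    using that width range[of "take n t"] unfolding \<psi>'_def
    by (auto intro!: zero simp: strs_def)
  have *: "run_plain (cnot_circ n n) (run_plain F' \<psi>) (k, t) = run_plain F' \<psi>' (k, t)"
    if t: "length t = L + 2 * n" for t
  proof -
    define g where "g = take n t @ drop (3 * n) t"
    define c where "c = take n (drop n t)"
    define y where "y = take n (drop (2 * n) t)"
    have g: "g \<in> strs L" and c: "length c = n" and y: "length y = n"
      using t width by (auto simp: g_def c_def y_def strs_def)
    have t_eq: "t = take n g @ (c @ y) @ drop n g"
      using t width unfolding g_def c_def y_def
      by (intro nth_equalityI) (auto simp: nth_append min_def)
    have "run_plain (cnot_circ n n) (run_plain F' \<psi>) (k, t)
        = run_plain F' \<psi> (k, take n g @ (map2 (\<noteq>) c (take n (drop n g)) @ y) @ drop n g)"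
    proof (subst run_cnot_circ)
      show "4 * n \<le> length t" using t width by simp
      have "map (\<lambda>p. if n \<le> p \<and> p < n + n then t ! p \<noteq> t ! (p + 2 * n) else t ! p) [0..<length t]
          = take n g @ (map2 (\<noteq>) c (take n (drop n g)) @ y) @ drop n g"
        using t width unfolding g_def c_def y_def
        by (intro nth_equalityI) (auto simp: nth_append min_def algebra_simps)
      then show "run_plain F' \<psi> (k, map (\<lambda>p. if n \<le> p \<and> p < n + n then t ! p \<noteq> t ! (p + 2 * n) else t ! p) [0..<length t])
        = run_plain F' \<psi> (k, take n g @ (map2 (\<noteq>) c (take n (drop n g)) @ y) @ drop n g)"
        by simp
    qed simp
    also have "\<dots> = (\<Sum>x\<in>strs n. \<psi> (k, x @ (map2 (\<noteq>) c (take n (drop n g)) @ y) @ zeros) * amp x g)"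
      using g c y width by (intro run_F' zero) (auto simp: strs_def)
    also have "\<dots> = (\<Sum>x\<in>strs n. \<psi>' (k, x @ (c @ y) @ zeros) * amp x g)"
    proof (rule sum.cong[OF refl])
      fix x assume x: "x \<in> strs n"
      \<comment> \<open>Either \<open>g\<close> carries the output \<open>f x\<close> and the two
        arguments coincide, or the factor \<open>amp x g\<close> vanishes.\<close>
      show "\<psi> (k, x @ (map2 (\<noteq>) c (take n (drop n g)) @ y) @ zeros) * amp x g
          = \<psi>' (k, x @ (c @ y) @ zeros) * amp x g"
        using x c amp_support[OF x g] by (cases "take n (drop n g) = f x") (auto simp: \<psi>'_def strs_def)
    qed
    also have "\<dots> = run_plain F' \<psi>' (k, take n g @ (c @ y) @ drop n g)"
      using g c y by (intro run_F'[symmetric] zero') auto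
    finally show ?thesis
      unfolding t_eq[symmetric] .
  qed
  have gF': "gates_only F'" and vF': "valid_circ (length s) F'"
    using gates_only_insert_qubits[OF gates] valid_insert_qubits[OF gates valid] s by auto
  have "run_plain (F' @ cnot_circ n n @ inverse_circ F') \<psi> (k, s)
      = run_plain (inverse_circ F') (run_plain F' \<psi>') (k, s)"
    unfolding run_plain_simps
    by (rule run_plain_cong[OF gates_only_inverse_circ[OF gF']]) (simp add: * s)
  also have "\<dots> = \<psi>' (k, s)"
    by (rule run_inverse_circ[OF gF' vF'])
  finally show ?thesis
    by (simp add: \<psi>'_def)
qed

text \<open>The phase is taken before the XOR, while C still holds f(z); \<open>U\<close> comes last
  because the XOR needs O as \<open>D\<close> left it.\<close>

definition inverter :: "instr list" where
  "inverter = CallD # cz_circ n n @ (F' @ cnot_circ n n @ inverse_circ F') @ [CallU]"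

lemma inverter_valid: "valid_circ (L + 2 * n) inverter"
proof -
  have "valid_circ (L + 2 * n) F'"
    by (rule valid_insert_qubits[OF gates valid])
  moreover have "valid_circ (L + 2 * n) (inverse_circ F')"
    using calculation by (rule valid_inverse_circ[OF gates_only_insert_qubits[OF gates]])
  ultimately show ?thesis
    using width gate_unitary_cnot gate_unitary_cz
    by (auto simp: inverter_def) (auto simp: valid_circ_def cz_circ_def cnot_circ_def)
qed

lemma inverter_calls:
  "length (filter is_CallD inverter) = 1" "length (filter is_CallU inverter) = 1"
  using gates_only_cz_circ gates_only_cnot_circ gates_only_insert_qubits[OF gates]
    gates_only_inverse_circ[OF gates_only_insert_qubits[OF gates]]
  by (simp_all add: inverter_def filter_gates_only is_CallD_def is_CallU_def)

lemma length_inverter: "length inverter = 2 * length F + 2 * n + 2"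
  by (simp add: inverter_def cz_circ_def cnot_circ_def)

text \<open>C is zero after the XOR exactly in the branches where it held f(z) before. The factor
  \<open>sqrt (2 ^ n)\<close> appears because a controlled-Z phase has modulus 1, whereas
  \<open>had\<close> has modulus \<open>1 / sqrt (2 ^ n)\<close>.\<close>

lemma run_inverter:
  assumes "0 < dK" and x: "x \<in> strs n" and y: "y \<in> strs n"
  shows "run dK D (2 * n) U n inverter (basis_vec (0, replicate (2 * n) False @ y @ zeros))
           (k, x @ replicate n False @ y @ zeros)
       = sqrt (2 ^ n) * (\<Sum>(k', z)\<in>basis dK n. U (k, x) (k', z) * (had n y (f z) * psi0 n D (k', z @ f z)))"
proof -
  define \<phi> where "\<phi> = apply_op dK (2 * n) D (basis_vec (0, replicate (2 * n) False @ y @ zeros))"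
  define \<psi> where "\<psi> = run_plain (cz_circ n n) \<phi>"
  define \<xi> where "\<xi> = run_plain (F' @ cnot_circ n n @ inverse_circ F') \<psi>"
  have \<phi>: "\<phi> (k, s) = (if drop (2 * n) s = y @ zeros then psi0 n D (k, take (2 * n) s) else 0)" for k s
  proof -
    have "\<phi> (k, s) = (\<Sum>b\<in>basis dK (2 * n). if b = (0, replicate (2 * n) False)
        then (if drop (2 * n) s = y @ zeros then psi0 n D (k, take (2 * n) s) else 0) else 0)"
      unfolding \<phi>_def apply_op_def prod.case
      by (intro sum.cong refl) (auto simp: basis_vec_def psi0_def basis_def strs_def split: if_splits)
    also have "\<dots> = (if drop (2 * n) s = y @ zeros then psi0 n D (k, take (2 * n) s) else 0)"
    proof -
      have "(0, replicate (2 * n) False) \<in> basis dK (2 * n)"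
        using \<open>0 < dK\<close> by (simp add: basis_def strs_def)
      then show ?thesis by simp
    qed
    finally show ?thesis .
  qed
  have zero: "\<psi> (k, s) = 0" if "length s = L + 2 * n" "drop (3 * n) s \<noteq> zeros" for k s
  proof -
    have "drop (2 * n) s \<noteq> y @ zeros"
    proof
      assume "drop (2 * n) s = y @ zeros"
      then have "drop n (drop (2 * n) s) = zeros"
        using y by (simp add: strs_def del: drop_drop)
      then show False
        using that(2) by (simp add: algebra_simps)
    qed
    then show ?thesis
      by (simp add: \<psi>_def run_cz_circ \<phi>)
  qed
  have \<xi>: "\<xi> (k', z @ replicate n False @ y @ zeros)
      = sqrt (2 ^ n) * (had n y (f z) * psi0 n D (k', z @ f z))" if z: "z \<in> strs n" for k' z
  proof -
    have fz: "length (f z) = n" and lz: "length z = n" and ly: "length y = n"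
      using z range[OF z] y by (simp_all add: strs_def)
    have xor0: "map2 (\<noteq>) (replicate n False) (f z) = f z"
      using fz by (intro nth_equalityI) auto
    have "\<xi> (k', z @ replicate n False @ y @ zeros) = \<psi> (k', z @ f z @ y @ zeros)"
      unfolding \<xi>_def using fz lz ly width xor0
      by (subst run_oracle) (auto intro: zero)
    also have "\<dots> = (-1) ^ card {i. i < n \<and> y ! i \<and> f z ! i} * psi0 n D (k', z @ f z)"
    proof -
      have "{i. i < n \<and> (z @ f z @ y @ zeros) ! (2 * n + i) \<and> (z @ f z @ y @ zeros) ! (n + i)}
          = {i. i < n \<and> y ! i \<and> f z ! i}"
        using fz lz ly by (auto simp: nth_append)
      then show ?thesis
        using fz lz ly by (simp add: \<psi>_def run_cz_circ \<phi>)
    qed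
    also have "\<dots> = sqrt (2 ^ n) * (had n y (f z) * psi0 n D (k', z @ f z))"
      by (simp add: had_def)
    finally show ?thesis .
  qed
  have "gates_only (cz_circ n n @ (F' @ cnot_circ n n @ inverse_circ F'))"
    using gates_only_cz_circ gates_only_cnot_circ gates_only_insert_qubits[OF gates]
      gates_only_inverse_circ[OF gates_only_insert_qubits[OF gates]] by simp
  from run_gates_only[OF this]
  have "run dK D (2 * n) U n inverter (basis_vec (0, replicate (2 * n) False @ y @ zeros))
      = apply_op dK n U \<xi>"
    unfolding inverter_def append_assoc[symmetric] \<xi>_def \<psi>_def \<phi>_def
    by (simp add: run_append)
  moreover have "apply_op dK n U \<xi> (k, x @ replicate n False @ y @ zeros)
      = (\<Sum>(k', z)\<in>basis dK n. U (k, x) (k', z) * \<xi> (k', z @ replicate n False @ y @ zeros))"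
    using x by (simp add: apply_op_def strs_def)
  moreover have "\<dots> = (\<Sum>(k', z)\<in>basis dK n. U (k, x) (k', z)
      * (sqrt (2 ^ n) * (had n y (f z) * psi0 n D (k', z @ f z))))"
    by (intro sum.cong refl) (auto simp: \<xi> basis_def)
  ultimately show ?thesis
    by (simp add: sum_distrib_left case_prod_beta mult_ac)
qed

end

section \<open>Norm estimates for revealing 1\<close>

lemma sum_basis_double:
  "(\<Sum>b\<in>basis dK (2 * n). h b) = (\<Sum>(k, t)\<in>basis dK n. \<Sum>c\<in>strs n. h (k, t @ c))"
proof -
  have "(\<Sum>(k, t)\<in>basis dK n. \<Sum>c\<in>strs n. h (k, t @ c))
      = (\<Sum>(b, c)\<in>basis dK n \<times> strs n. h (fst b, snd b @ c))"
    by (simp add: sum.cartesian_product case_prod_beta)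
  also have "\<dots> = (\<Sum>b\<in>basis dK (2 * n). h b)"
    by (rule sum.reindex_bij_witness[where i = "\<lambda>(k, s). ((k, take n s), drop n s)"
          and j = "\<lambda>(b, c). (fst b, snd b @ c)"])
      (auto simp: basis_def strs_def)
  finally show ?thesis ..
qed

lemma sum_basis_subset:
  assumes "W \<subseteq> strs n" "\<And>b. 0 \<le> (h b :: real)"
  shows "(\<Sum>k<dK. \<Sum>x\<in>W. h (k, x)) \<le> (\<Sum>b\<in>basis dK n. h b)"
proof -
  have "(\<Sum>k<dK. \<Sum>x\<in>W. h (k, x)) = (\<Sum>b\<in>{..<dK} \<times> W. h b)"
    by (simp add: sum.cartesian_product)
  also have "\<dots> \<le> (\<Sum>b\<in>basis dK n. h b)"
    using assms by (intro sum_mono2) (auto simp: basis_def)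
  finally show ?thesis .
qed

lemma cmod_had: "(cmod (had n z c))\<^sup>2 = 1 / 2 ^ n"
  by (simp add: had_def norm_divide norm_power power_divide)

text \<open>Cauchy-Schwarz: \<open>2 ^ n\<close> entries of squared modulus \<open>1 / 2 ^ n\<close>
  make the conjugate basis vector a unit vector.\<close>

lemma had_amplitude_le:
  "(cmod (\<Sum>c\<in>strs n. had n z c * v c))\<^sup>2 \<le> (\<Sum>c\<in>strs n. (cmod (v c))\<^sup>2)"
proof -
  have "cmod (\<Sum>c\<in>strs n. had n z c * v c) \<le> (\<Sum>c\<in>strs n. cmod (had n z c) * cmod (v c))"
    using norm_sum[of "\<lambda>c. had n z c * v c" "strs n"] by (simp add: norm_mult)
  then have "(cmod (\<Sum>c\<in>strs n. had n z c * v c))\<^sup>2 \<le> (\<Sum>c\<in>strs n. cmod (had n z c) * cmod (v c))\<^sup>2"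
    by (intro power_mono) auto
  also have "\<dots> \<le> (\<Sum>c\<in>strs n. (cmod (had n z c))\<^sup>2) * (\<Sum>c\<in>strs n. (cmod (v c))\<^sup>2)"
    by (rule Cauchy_Schwarz_ineq_sum)
  also have "\<dots> = (\<Sum>c\<in>strs n. (cmod (v c))\<^sup>2)"
    by (simp add: cmod_had card_strs)
  finally show ?thesis .
qed

text \<open>The component of \<open>U \<phi>\<close> along the vector with k on K, x on O and f(x)
  in the conjugate basis on C. These vectors are orthonormal, so the squared moduli over x in W sum
  to the squared norm of \<open>P1 U \<phi>\<close>.\<close>

definition reveal_amp :: "(bool list \<Rightarrow> bool list) \<Rightarrow> nat \<Rightarrow> nat \<Rightarrow> qop \<Rightarrow> vec \<Rightarrow> bas \<Rightarrow> complex" where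
  "reveal_amp f n dK U \<phi> = (\<lambda>(k, x). \<Sum>c\<in>strs n. had n (f x) c * apply_op dK n U \<phi> (k, x @ c))"

lemma apply_op_basis:
  "b \<in> basis dK n \<Longrightarrow> apply_op dK n U \<phi> (fst b, snd b @ c) = (\<Sum>a\<in>basis dK n. U b a * \<phi> (fst a, snd a @ c))"
  by (auto simp: apply_op_def basis_def strs_def intro!: sum.cong)

lemma reveal_amp_add:
  "reveal_amp f n dK U (\<lambda>b. \<phi> b + \<psi> b) b = reveal_amp f n dK U \<phi> b + reveal_amp f n dK U \<psi> b"
  by (cases b) (simp add: reveal_amp_def apply_op_def case_prod_beta sum.distrib distrib_left)

text \<open>For each fixed content of C, \<open>U\<close> is an isometry on K and O; projecting C
  onto a unit vector afterwards can only lose norm.\<close>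

lemma reveal_amp_bound:
  assumes W: "W \<subseteq> strs n" and U: "unitary_on dK n U"
  shows "(\<Sum>b\<in>{..<dK} \<times> W. (cmod (reveal_amp f n dK U \<phi> b))\<^sup>2) \<le> (\<Sum>b\<in>basis dK (2 * n). (cmod (\<phi> b))\<^sup>2)"
proof -
  have "(\<Sum>b\<in>{..<dK} \<times> W. (cmod (reveal_amp f n dK U \<phi> b))\<^sup>2)
      \<le> (\<Sum>b\<in>basis dK n. (cmod (reveal_amp f n dK U \<phi> b))\<^sup>2)"
    using W by (intro sum_mono2) (auto simp: basis_def)
  also have "\<dots> \<le> (\<Sum>b\<in>basis dK n. \<Sum>c\<in>strs n. (cmod (apply_op dK n U \<phi> (fst b, snd b @ c)))\<^sup>2)"
    unfolding reveal_amp_def case_prod_beta by (intro sum_mono had_amplitude_le)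
  also have "\<dots> = (\<Sum>c\<in>strs n. \<Sum>b\<in>basis dK n. (cmod (\<Sum>a\<in>basis dK n. U b a * \<phi> (fst a, snd a @ c)))\<^sup>2)"
    by (subst sum.swap) (simp add: apply_op_basis)
  also have "\<dots> = (\<Sum>c\<in>strs n. \<Sum>a\<in>basis dK n. (cmod (\<phi> (fst a, snd a @ c)))\<^sup>2)"
    using U unfolding unitary_on_def by (intro sum.cong[OF refl] isometry_sum finite_basis) blast
  also have "\<dots> = (\<Sum>b\<in>basis dK (2 * n). (cmod (\<phi> b))\<^sup>2)"
    by (subst sum.swap) (simp add: sum_basis_double case_prod_beta)
  finally show ?thesis .
qed

text \<open>This is \<open>Q \<psi>\<close> for the projection Q onto consistent O and C.\<close>

definition honest_part :: "(bool list \<Rightarrow> bool list) \<Rightarrow> nat \<Rightarrow> vec \<Rightarrow> vec" where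
  "honest_part f n \<psi> = (\<lambda>(k, s). if drop n s = f (take n s) then \<psi> (k, s) else 0)"

text \<open>In the honest part O determines C, so the sum over \<open>c\<close> collapses. The
  result is, up to scaling, the amplitude of \<open>run_inverter\<close> at
  \<open>y = f x\<close>.\<close>

lemma reveal_amp_honest_part:
  assumes "\<And>x. x \<in> strs n \<Longrightarrow> f x \<in> strs n" "x \<in> strs n"
  shows "reveal_amp f n dK U (honest_part f n \<psi>) (k, x)
    = (\<Sum>(k', z)\<in>basis dK n. U (k, x) (k', z) * (had n (f x) (f z) * \<psi> (k', z @ f z)))"
proof -
  have "reveal_amp f n dK U (honest_part f n \<psi>) (k, x)
      = (\<Sum>c\<in>strs n. \<Sum>(k', z)\<in>basis dK n. if c = f z then U (k, x) (k', z) * (had n (f x) c * \<psi> (k', z @ c)) else 0)"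
    using assms(2)
    by (auto simp: reveal_amp_def apply_op_def honest_part_def basis_def strs_def sum_distrib_left
        intro!: sum.cong)
  also have "\<dots> = (\<Sum>(k', z)\<in>basis dK n. \<Sum>c\<in>strs n. if c = f z then U (k, x) (k', z) * (had n (f x) c * \<psi> (k', z @ c)) else 0)"
    by (subst sum.swap) (simp add: case_prod_beta)
  also have "\<dots> = (\<Sum>(k', z)\<in>basis dK n. U (k, x) (k', z) * (had n (f x) (f z) * \<psi> (k', z @ f z)))"
    using assms(1) by (intro sum.cong refl) (auto simp: basis_def)
  finally show ?thesis .
qed

lemma psi0_norm:
  assumes "0 < dK" "unitary_on dK (2 * n) D"
  shows "(\<Sum>b\<in>basis dK (2 * n). (cmod (psi0 n D b))\<^sup>2) = 1"
proof -
  define e :: bas where "e = (0, replicate (2 * n) False)"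
  have "e \<in> basis dK (2 * n)"
    using assms(1) by (simp add: e_def basis_def strs_def)
  then have "(\<Sum>b\<in>basis dK (2 * n). cnj (D b e) * D b e) = 1"
    using assms(2) by (simp add: unitary_on_def)
  then have "complex_of_real (\<Sum>b\<in>basis dK (2 * n). (cmod (D b e))\<^sup>2) = 1"
    by (simp only: of_real_sum complex_norm_square mult.commute)
  then have "(\<Sum>b\<in>basis dK (2 * n). (cmod (D b e))\<^sup>2) = 1"
    using of_real_eq_1_iff by blast
  then show ?thesis
    by (simp add: psi0_def e_def)
qed

text \<open>The hypothesis bounds squared norms, so the gap passes through
  \<open>p\<^sup>2 - q\<^sup>2 = (p - q) * (p + q)\<close>, where \<open>p\<close>,
  \<open>q\<close>, \<open>e\<close> are the norms of the parts of \<open>\<psi>\<close>,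
  \<open>R\<close>, \<open>Q\<close> that reveal 1. The triangle inequality gives
  \<open>p - q \<le> e\<close>, and \<open>p + q \<le> 2\<close>, hence
  \<open>e \<ge> \<epsilon> / 2\<close>.\<close>

lemma reveal_tradeoff:
  fixes \<epsilon> :: real
  assumes W: "W \<subseteq> strs n" and dK: "0 < dK" and D: "unitary_on dK (2 * n) D" and U: "unitary_on dK n U"
    and range: "\<And>x. x \<in> strs n \<Longrightarrow> f n x \<in> strs n"
    and b: "b0 f n W dK D + b1 f n W dK D U \<ge> 1 + \<epsilon>" and "0 \<le> \<epsilon>"
  shows "\<epsilon>\<^sup>2 / 4 \<le> (\<Sum>b\<in>{..<dK} \<times> W. (cmod (reveal_amp (f n) n dK U (honest_part (f n) n (psi0 n D)) b))\<^sup>2)"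
proof -
  define \<psi> where "\<psi> = psi0 n D"
  define Q where "Q = honest_part (f n) n \<psi>"
  define R where "R = (\<lambda>b. \<psi> b - Q b)"
  define A where "A \<phi> = (\<lambda>b. cmod (reveal_amp (f n) n dK U \<phi> b))" for \<phi>
  define S where "S = {..<dK} \<times> W"
  have total: "(\<Sum>b\<in>basis dK (2 * n). (cmod (\<psi> b))\<^sup>2) = 1"
    unfolding \<psi>_def by (rule psi0_norm[OF dK D])
  have b0_le: "b0 f n W dK D \<le> (\<Sum>b\<in>basis dK (2 * n). (cmod (Q b))\<^sup>2)"
  proof -
    \<comment> \<open>Passing from \<open>W\<close> to all strings of length \<open>n\<close> only
      adds nonnegative terms.\<close>
    have "b0 f n W dK D \<le> (\<Sum>(k, t)\<in>basis dK n. (cmod (\<psi> (k, t @ f n t)))\<^sup>2)"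
      using sum_basis_subset[OF W, of "\<lambda>(k, t). (cmod (\<psi> (k, t @ f n t)))\<^sup>2" dK]
      by (auto simp: b0_def \<psi>_def)
    also have "\<dots> = (\<Sum>(k, t)\<in>basis dK n. \<Sum>c\<in>strs n. if c = f n t then (cmod (\<psi> (k, t @ c)))\<^sup>2 else 0)"
      using range by (intro sum.cong refl) (auto simp: basis_def)
    also have "\<dots> = (\<Sum>(k, t)\<in>basis dK n. \<Sum>c\<in>strs n. (cmod (Q (k, t @ c)))\<^sup>2)"
      unfolding Q_def honest_part_def
      by (intro sum.cong refl) (auto simp: basis_def strs_def intro!: sum.cong)
    finally show ?thesis
      by (simp add: sum_basis_double)
  qed
  \<comment> \<open>\<open>Q\<close> and \<open>R\<close> have disjoint supports, so their squared
    norms add up to that of \<open>\<psi>\<close>.\<close>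
  have "(\<Sum>b\<in>basis dK (2 * n). (cmod (Q b))\<^sup>2) + (\<Sum>b\<in>basis dK (2 * n). (cmod (R b))\<^sup>2) = 1"
    unfolding total[symmetric] sum.distrib[symmetric]
    by (intro sum.cong refl) (auto simp: R_def Q_def honest_part_def)
  with b0_le have R_le: "(\<Sum>b\<in>basis dK (2 * n). (cmod (R b))\<^sup>2) \<le> 1 - b0 f n W dK D"
    by linarith
  have b1_eq: "b1 f n W dK D U = (\<Sum>b\<in>S. (A \<psi> b)\<^sup>2)"
    by (simp add: b1_def A_def S_def \<psi>_def psi1_def reveal_amp_def sum.cartesian_product case_prod_beta)
  have A_add: "A \<psi> b \<le> A Q b + A R b" for b
  proof -
    have "reveal_amp (f n) n dK U \<psi> b = reveal_amp (f n) n dK U Q b + reveal_amp (f n) n dK U R b"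
      using reveal_amp_add[of "f n" n dK U Q R b] by (simp add: R_def)
    then show ?thesis
      unfolding A_def by (simp only: norm_triangle_ineq)
  qed
  define p where "p = L2_set (A \<psi>) S"
  define q where "q = L2_set (A R) S"
  define e where "e = L2_set (A Q) S"
  have nonneg: "0 \<le> p" "0 \<le> q" "0 \<le> e"
    by (simp_all add: p_def q_def e_def)
  have p2: "p\<^sup>2 = b1 f n W dK D U"
    unfolding p_def L2_set_def b1_eq by (simp add: sum_nonneg)
  have p_le: "p \<le> 1"
    using reveal_amp_bound[OF W U, of "f n" \<psi>] total
    by (simp add: p_def L2_set_def S_def A_def)
  have q2: "q\<^sup>2 \<le> 1 - b0 f n W dK D"
    using reveal_amp_bound[OF W U, of "f n" R] R_le
    by (simp add: q_def L2_set_def S_def A_def sum_nonneg)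
  have "0 \<le> b0 f n W dK D"
    by (simp add: b0_def sum_nonneg)
  with q2 have q_le: "q \<le> 1"
    using power2_le_imp_le[of q 1] by simp
  have "p \<le> L2_set (\<lambda>b. A Q b + A R b) S"
    unfolding p_def by (rule L2_set_mono, rule A_add) (simp add: A_def)
  also have "\<dots> \<le> e + q"
    unfolding e_def q_def by (rule L2_set_triangle_ineq)
  finally have pe: "p - q \<le> e" by simp
  have "\<epsilon> \<le> p\<^sup>2 - q\<^sup>2"
    using b p2 q2 by linarith
  also have "\<dots> = (p - q) * (p + q)"
    by (simp add: power2_eq_square algebra_simps)
  also have "\<dots> \<le> e * 2"
    using pe p_le q_le nonneg
    by (intro order_trans[OF mult_right_mono[OF pe] mult_left_mono]) auto
  finally have "(\<epsilon> / 2)\<^sup>2 \<le> e\<^sup>2"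
    using \<open>0 \<le> \<epsilon>\<close> by (intro power_mono) auto
  moreover have "e\<^sup>2 = (\<Sum>b\<in>S. (A Q b)\<^sup>2)"
    by (simp add: e_def L2_set_def sum_nonneg)
  ultimately show ?thesis
    by (simp add: power_divide S_def A_def Q_def \<psi>_def)
qed

section \<open>From amplitudes to the success probability\<close>

lemma inv_success_nonneg: "0 \<le> inv_success f n W dK D U L gs"
  unfolding inv_success_def by (intro sum_nonneg mult_nonneg_nonneg) (auto intro!: sum_nonneg)

text \<open>Every element of the image of W has at least one preimage, so its conditional weight is
at least 1 / 2^n, which makes up for the normalisation of the Hadamard amplitudes.\<close>

lemma inv_success_ge:
  fixes a :: "bool list \<Rightarrow> vec"
  assumes W: "W \<subseteq> strs n" and range: "\<And>x. x \<in> strs n \<Longrightarrow> f n x \<in> strs n" and L: "3 * n \<le> L"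
    and amp: "\<And>k x y. x \<in> strs n \<Longrightarrow> y \<in> strs n \<Longrightarrow>
      run dK D (2 * n) U n gs (basis_vec (0, replicate (2 * n) False @ y @ replicate (L - 3 * n) False))
        (k, x @ replicate n False @ y @ replicate (L - 3 * n) False) = sqrt (2 ^ n) * a y (k, x)"
  shows "(\<Sum>(k, x)\<in>{..<dK} \<times> W. (cmod (a (f n x) (k, x)))\<^sup>2) \<le> inv_success f n W dK D U L gs"
proof -
  \<comment> \<open>The openings in \<open>W\<close> are grouped by the challenge \<open>y\<close>
    that they answer.\<close>
  define V where "V y = {b \<in> {..<dK} \<times> W. f n (snd b) = y}" for y
  define P where "P y = (\<Sum>(k, s)\<in>basis dK L.
           if take n s \<in> W \<and> f n (take n s) = y
           then (cmod (run dK D (2 * n) U n gs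
                  (basis_vec (0, replicate (2 * n) False @ y @ replicate (L - 3 * n) False)) (k, s)))\<^sup>2
           else 0)" for y
  have finW: "finite W"
    using W finite_strs finite_subset by blast
  have P: "2 ^ n * (\<Sum>b\<in>V y. (cmod (a y b))\<^sup>2) \<le> P y" if y: "y \<in> f n ` W" for y
  proof -
    define e where "e = (\<lambda>(k :: nat, x). (k, x @ replicate n False @ y @ replicate (L - 3 * n) False))"
    define h where "h = (\<lambda>(k, s). if take n s \<in> W \<and> f n (take n s) = y
           then (cmod (run dK D (2 * n) U n gs
                  (basis_vec (0, replicate (2 * n) False @ y @ replicate (L - 3 * n) False)) (k, s)))\<^sup>2
           else 0)"
    have ys: "y \<in> strs n" using y W range by blast
    have lenV: "snd b \<in> strs n" "snd b \<in> W" "f n (snd b) = y" "fst b < dK" if "b \<in> V y" for b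
      using that W by (auto simp: V_def)
    have "2 ^ n * (\<Sum>b\<in>V y. (cmod (a y b))\<^sup>2) = (\<Sum>b\<in>V y. h (e b))"
      unfolding sum_distrib_left
    proof (rule sum.cong[OF refl])
      fix b assume b: "b \<in> V y"
      obtain k x where kx: "b = (k, x)" by (cases b)
      have "length x = n"
        using lenV(1)[OF b] by (simp add: kx strs_def)
      then show "2 ^ n * (cmod (a y b))\<^sup>2 = h (e b)"
        using lenV[OF b] ys amp[of x y k]
        by (simp add: kx h_def e_def norm_mult power_mult_distrib)
    qed
    also have "\<dots> = (\<Sum>b\<in>e ` V y. h b)"
      by (subst sum.reindex) (auto simp: inj_on_def e_def dest: lenV simp: strs_def)
    \<comment> \<open>Final states with nonzero C, or with other contents on the remaining wires,
      only add to the success probability.\<close>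
    also have "\<dots> \<le> (\<Sum>b\<in>basis dK L. h b)"
    proof (rule sum_mono2)
      show "e ` V y \<subseteq> basis dK L"
        using lenV ys L by (fastforce simp: e_def basis_def strs_def)
    qed (auto simp: h_def)
    also have "\<dots> = P y"
      by (simp add: P_def h_def)
    finally show ?thesis .
  qed
  have weight: "1 / 2 ^ n \<le> real (card {x\<in>strs n. f n x = y}) / real (card {x\<in>strs n. f n x \<in> f n ` W})"
    if y: "y \<in> f n ` W" for y
  proof (rule frac_le)
    have pos: "0 < card {x\<in>strs n. f n x = y}"
      using y W by (subst card_gt_0_iff) auto
    then show "1 \<le> real (card {x\<in>strs n. f n x = y})" by simp
    have "card {x\<in>strs n. f n x \<in> f n ` W} \<le> card (strs n)"
      by (rule card_mono) auto
    then show "real (card {x\<in>strs n. f n x \<in> f n ` W}) \<le> 2 ^ n"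
      by (simp add: card_strs)
    show "0 < real (card {x\<in>strs n. f n x \<in> f n ` W})"
      using y W by (auto simp: card_gt_0_iff)
  qed simp
  have fimg: "(\<lambda>b. f n (snd b)) ` ({..<dK} \<times> W) \<subseteq> f n ` W" by auto
  have "(\<Sum>(k, x)\<in>{..<dK} \<times> W. (cmod (a (f n x) (k, x)))\<^sup>2)
      = (\<Sum>y\<in>f n ` W. \<Sum>b\<in>V y. (cmod (a (f n (snd b)) b))\<^sup>2)"
    unfolding V_def case_prod_beta prod.collapse
    by (rule sum.group[symmetric, OF _ _ fimg]) (use finW in auto)
  also have "\<dots> = (\<Sum>y\<in>f n ` W. \<Sum>b\<in>V y. (cmod (a y b))\<^sup>2)"
    by (intro sum.cong refl) (auto simp: V_def)
  also have "\<dots> \<le> (\<Sum>y\<in>f n ` W. (real (card {x\<in>strs n. f n x = y}) / real (card {x\<in>strs n. f n x \<in> f n ` W})) * P y)"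
  proof (rule sum_mono)
    fix y assume y: "y \<in> f n ` W"
    have "(\<Sum>b\<in>V y. (cmod (a y b))\<^sup>2) = 1 / 2 ^ n * (2 ^ n * (\<Sum>b\<in>V y. (cmod (a y b))\<^sup>2))"
      by simp
    also have "\<dots> \<le> (real (card {x\<in>strs n. f n x = y}) / real (card {x\<in>strs n. f n x \<in> f n ` W})) * P y"
      by (rule mult_mono[OF weight[OF y] P[OF y]]) (auto intro!: mult_nonneg_nonneg sum_nonneg)
    finally show "(\<Sum>b\<in>V y. (cmod (a y b))\<^sup>2)
        \<le> (real (card {x\<in>strs n. f n x = y}) / real (card {x\<in>strs n. f n x \<in> f n ` W})) * P y" .
  qed
  also have "\<dots> = inv_success f n W dK D U L gs"
    by (simp add: inv_success_def P_def)
  finally show ?thesis .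
qed

section \<open>Size bound and conclusion\<close>

text \<open>Covers \<open>2 * length F + 2 * n + 2\<close> instructions and \<open>L + 2 * n\<close>
  wires when \<open>length F + L \<le> p n\<close>. Raising the degree by one lets the power absorb
  the linear term even for \<open>d = 0\<close>.\<close>

lemma poly_bounded_inverter_size:
  assumes "poly_bounded p"
  shows "poly_bounded (\<lambda>n. 2 * p n + 4 * n + 2)"
proof -
  obtain c d where c: "\<And>n. real (p n) \<le> c * (real n + 1) ^ d"
    using assms unfolding poly_bounded_def by blast
  have c0: "0 \<le> c"
    using c[of 0] by simp
  have "real (2 * p n + 4 * n + 2) \<le> (2 * c + 4) * (real n + 1) ^ (d + 1)" for n
  proof -
    have "real (p n) \<le> c * (real n + 1) ^ (d + 1)"
      using c[of n] mult_left_mono[OF power_increasing[of d "d + 1" "real n + 1"] c0] by simp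
    moreover have "real n + 1 \<le> (real n + 1) ^ (d + 1)"
      using power_increasing[of 1 "d + 1" "real n + 1"] by simp
    ultimately show ?thesis
      by (simp add: algebra_simps del: power_Suc)
  qed
  then show ?thesis
    unfolding poly_bounded_def by blast
qed

theorem theorem1:
  fixes f :: "nat \<Rightarrow> bool list \<Rightarrow> bool list" and s :: "nat \<Rightarrow> real"
  assumes "qow_secure f s"
  shows "\<exists>c > 0. \<exists>p. poly_bounded p \<and> (\<exists>N. \<forall>n \<ge> N.
     \<forall>(W :: bool list set) (dK :: nat) (D :: qop) (U :: qop).
       W \<subseteq> strs n \<and> 0 < dK \<and> unitary_on dK (2 * n) D \<and> unitary_on dK n U \<and>
       b0 f n W dK D + b1 f n W dK D U \<ge> 1 + 1 / sqrt (s n)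
       \<longrightarrow> (\<exists>L is. 3 * n \<le> L \<and> valid_circ L is \<and>
              length (filter is_CallD is) = 1 \<and> length (filter is_CallU is) = 1 \<and>
              length is + L \<le> p n \<and>
              inv_success f n W dK D U L is \<ge> c / s n))"
proof -
  have range: "\<And>n x. x \<in> strs n \<Longrightarrow> f n x \<in> strs n" and "qcomputable f"
    using assms by (auto simp: qow_secure_def)
  then obtain p where p: "poly_bounded p" and "\<And>n. \<exists>L F.
      2 * n \<le> L \<and> valid_circ L F \<and> gates_only F \<and> length F + L \<le> p n \<and>
      (\<forall>x\<in>strs n. (\<Sum>s\<in>strs L. if take n (drop n s) = f n x
          then (cmod (run_plain F (basis_vec (0, x @ replicate (L - n) False)) (0, s)))\<^sup>2 else 0) = 1)"
    unfolding qcomputable_def by blast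
  with range have circ: "\<exists>L F. exact_circuit (f n) n L F \<and> length F + L \<le> p n" for n
    unfolding exact_circuit_def by meson
  have "\<exists>L gs. 3 * n \<le> L \<and> valid_circ L gs \<and>
              length (filter is_CallD gs) = 1 \<and> length (filter is_CallU gs) = 1 \<and>
              length gs + L \<le> 2 * p n + 4 * n + 2 \<and>
              inv_success f n W dK D U L gs \<ge> (1 / 4) / s n"
    if W: "W \<subseteq> strs n" and dK: "0 < dK" and D: "unitary_on dK (2 * n) D" and U: "unitary_on dK n U"
      and b: "b0 f n W dK D + b1 f n W dK D U \<ge> 1 + 1 / sqrt (s n)" for n W dK D U
  proof -
    obtain L F where "exact_circuit (f n) n L F" and size: "length F + L \<le> p n"
      using circ by blast
    then interpret exact_circuit "f n" n L F by blast
    \<comment> \<open>The \<open>2 * n\<close> additional wires are the gap for C and y.\<close>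
    define T where "T = L + 2 * n"
    have T: "3 * n \<le> T" "T - 3 * n = L - n"
      using width by (auto simp: T_def)
    have "(1 / 4) / s n \<le> inv_success f n W dK D U T inverter"
    \<comment> \<open>\<open>s\<close> may take any real value. For \<open>s n \<le> 0\<close> the
      required bound is at most 0, with division by zero yielding 0.\<close>
    proof (cases "0 < s n")
      case True
      define a where "a y = (\<lambda>(k, x). \<Sum>(k', z)\<in>basis dK n.
          U (k, x) (k', z) * (had n y (f n z) * psi0 n D (k', z @ f n z)))" for y
      \<comment> \<open>The tradeoff is applied with \<open>\<epsilon> = 1 / sqrt (s n)\<close>; its
        denominator 4 is the source of the final constant.\<close>
      have "(1 / 4) / s n = (1 / sqrt (s n))\<^sup>2 / 4"
        using True by (simp add: power_divide)
      also have "\<dots> \<le> (\<Sum>b\<in>{..<dK} \<times> W. (cmod (reveal_amp (f n) n dK U (honest_part (f n) n (psi0 n D)) b))\<^sup>2)"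
        using True by (intro reveal_tradeoff[where f = f] W dK D U range b) auto
      also have "\<dots> = (\<Sum>(k, x)\<in>{..<dK} \<times> W. (cmod (a (f n x) (k, x)))\<^sup>2)"
        using W range by (intro sum.cong refl) (auto simp: a_def reveal_amp_honest_part)
      also have "\<dots> \<le> inv_success f n W dK D U T inverter"
      proof (rule inv_success_ge[where f = f, OF W range T(1)])
        fix k x y
        assume "x \<in> strs n" "y \<in> strs n"
        from run_inverter[OF dK this, of D U k]
        show "run dK D (2 * n) U n inverter (basis_vec (0, replicate (2 * n) False @ y @ replicate (T - 3 * n) False))
            (k, x @ replicate n False @ y @ replicate (T - 3 * n) False) = sqrt (2 ^ n) * a y (k, x)"
          by (simp add: T(2) a_def)
      qed
      finally show ?thesis .
    next
      case False
      then have "(1 / 4) / s n \<le> 0"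
        by (simp add: divide_nonneg_nonpos)
      also have "\<dots> \<le> inv_success f n W dK D U T inverter"
        by (rule inv_success_nonneg)
      finally show ?thesis .
    qed
    moreover have "length inverter + T \<le> 2 * p n + 4 * n + 2"
      using size by (simp add: length_inverter T_def)
    ultimately show ?thesis
      using T inverter_valid inverter_calls unfolding T_def by blast
  qed
  note inverter = this
  show ?thesis
    by (rule exI[of _ "1 / 4"], rule conjI, simp, rule exI[of _ "\<lambda>n. 2 * p n + 4 * n + 2"],
        rule conjI, rule poly_bounded_inverter_size[OF p], rule exI[of _ 0]) (use inverter in blast)
qed

end
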